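(* For $\gamma\in[0,3]$ and $x\in[0,\pi/2)$ let $f_\gamma(x)=x^{3-\gamma}\tan^{\gamma}x$. The following two inequalities hold: (a) for every $x\in(0,\pi/2)$ we have $f_1(x)<3(\tan x-x)$; (b) for every $x\in(0,\pi/2)$ we have $3(\tan x-x)<f_{6/5}(x)$. Equivalently, for every $x\in(0,\pi/2)$, $$x+\frac{1}{3}x^2\tan x<\tan x<x+\frac{1}{3}x^{9/5}\tan^{6/5}x.$$
   Context: Here $\tan^{\gamma}x$ means $(\tan x)^{\gamma}$, a real power of the real number $\tan x$, which is positive for $x\in(0,\pi/2)$. *)

theory Defs
  imports Complex_Main
begin

text \<open>Only used for exponents in \<open>[0,3]\<close> and arguments in \<open>[0, pi/2)\<close>. At \<open>x = 0\<close> the convention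
  \<open>0 powr a = 0\<close> (also for \<open>a = 0\<close>) gives the value \<open>0\<close> for every exponent, as does the
  usual convention \<open>0\<^sup>0 = 1\<close>, since the two exponents add up to \<open>3\<close>.\<close>

definition f :: "real \<Rightarrow> real \<Rightarrow> real" where
  "f \<gamma> x = x powr (3 - \<gamma>) * tan x powr \<gamma>"

end

theory Submission imports Defs "HOL-Real_Asymp.Real_Asymp" begin

text \<open>
  Multiplied by \<open>cos x\<close>, the lower bound says that \<open>3 (sin x - x cos x) - x\<^sup>2 sin x\<close> is positive.
  This function vanishes at \<open>0\<close> and its derivative is \<open>x (sin x - x cos x)\<close>, which is positive
  because \<open>x < tan x\<close> (\<open>lower_bound\<close>).

  For the upper bound, write \<open>t = tan x\<close> and consider the logarithm of the ratio of the two sides,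
  \<open>h(x) = 9/5 ln x + 6/5 ln t - ln (3 (t - x))\<close>. Since \<open>t - x\<close> behaves like \<open>x\<^sup>3 / 3\<close> near \<open>0\<close>,
  \<open>h\<close> tends to \<open>0\<close> there, so it is enough that \<open>h\<close> is strictly increasing (\<open>upper_bound\<close>). After
  clearing denominators and multiplying by \<open>cos\<^sup>3 x\<close>, the claim \<open>h' > 0\<close> becomes the trigonometric
  inequality
    \<open>E(x) = 9 sin\<^sup>2 x cos x - x sin (3 x) - 6 x\<^sup>2 cos x > 0\<close>
  (\<open>log_ratio_derivative_pos\<close>). The power series of \<open>E\<close> is \<open>\<Sum>n. (-1)\<^sup>n c\<^sub>n x\<^sup>2\<^sup>n\<close> with explicit
  coefficients \<open>c\<^sub>n\<close> (\<open>trig_expression_sums\<close>). They vanish for \<open>n < 4\<close>, which reflects that the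
  expansions at \<open>0\<close> of the two sides of the upper bound share their first two terms. From \<open>n = 4\<close> on they are positive and drop
  by a factor of at least \<open>4\<close> at each step, whereas \<open>x\<^sup>2 < (pi/2)\<^sup>2 < 4\<close>. So \<open>E(x)\<close> is an alternating
  series with strictly decreasing terms and a positive first term (\<open>trig_expression_pos\<close>).
\<close>

section \<open>The lower bound\<close>

lemma sin_minus_x_cos_pos:
  fixes x :: real
  assumes "0 < x" "x < pi / 2"
  shows "0 < sin x - x * cos x"
proof -
  let ?g = "\<lambda>x::real. sin x - x * cos x"
  have "?g 0 < ?g x"
  proof (rule DERIV_pos_imp_increasing_open[OF assms(1)])
    fix y assume y: "0 < y" "y < x"
    have "(?g has_real_derivative y * sin y) (at y)"
      by (auto intro!: derivative_eq_intros)
    moreover have "0 < y * sin y" using y assms by (auto intro!: mult_pos_pos sin_gt_zero)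
    ultimately show "\<exists>d. (?g has_real_derivative d) (at y) \<and> 0 < d" by blast
  qed (intro continuous_intros)
  then show ?thesis by simp
qed

lemma x_less_tan:
  fixes x :: real
  assumes "0 < x" "x < pi / 2"
  shows "x < tan x"
  using sin_minus_x_cos_pos[OF assms] cos_gt_zero_pi[of x] assms
  by (simp add: tan_def field_simps)

lemma lower_bound:
  fixes x :: real
  assumes "0 < x" "x < pi / 2"
  shows "x ^ 2 * tan x < 3 * (tan x - x)"
proof -
  let ?g = "\<lambda>x::real. 3 * (sin x - x * cos x) - x ^ 2 * sin x"
  have "?g 0 < ?g x"
  proof (rule DERIV_pos_imp_increasing_open[OF assms(1)])
    fix y assume y: "0 < y" "y < x"
    have "(?g has_real_derivative y * (sin y - y * cos y)) (at y)"
      by (auto intro!: derivative_eq_intros simp: algebra_simps power2_eq_square)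
    moreover have "0 < y * (sin y - y * cos y)"
      using y assms by (auto intro!: mult_pos_pos sin_minus_x_cos_pos simp del: diff_gt_0_iff_gt)
    ultimately show "\<exists>d. (?g has_real_derivative d) (at y) \<and> 0 < d" by blast
  qed (intro continuous_intros)
  then show ?thesis using cos_gt_zero_pi[of x] assms
    by (simp add: tan_def field_simps)
qed

section \<open>A trigonometric inequality by power series\<close>

text \<open>
  The summands \<open>9\<^sup>n\<close> come from \<open>cos (3 x)\<close> and \<open>x sin (3 x)\<close>. The common denominator \<open>12 (2 n)!\<close>
  leaves a numerator whose growth can be compared directly.
\<close>
definition trig_coeff :: "nat \<Rightarrow> real" where
  "trig_coeff n = (9 ^ n * (8 * real n - 27) + (288 * real n ^ 2 - 144 * real n + 27))
     / (12 * fact (2 * n))"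

lemma trig_coeff_eq_0: "n < 4 \<Longrightarrow> trig_coeff n = 0"
  by (auto simp: trig_coeff_def less_Suc_eq numeral_eq_Suc)

lemma trig_coeff_pos:
  assumes n: "4 \<le> n"
  shows "0 < trig_coeff n"
proof -
  have "0 < 9 ^ n * (8 * real n - 27)" using n by simp
  moreover have "0 \<le> (288 * real n - 144) * real n" using n by (intro mult_nonneg_nonneg) auto
  then have "0 \<le> 288 * real n ^ 2 - 144 * real n + 27"
    by (simp add: power2_eq_square algebra_simps)
  ultimately show ?thesis
    unfolding trig_coeff_def by (intro divide_pos_pos add_pos_nonneg) auto
qed

text \<open>
  In the quotient of consecutive coefficients the dominant part of the numerator gains roughly
  a factor \<open>9 (8 n - 19) / (8 n - 27)\<close>, while the factorial contributes \<open>(2 n + 2) (2 n + 1) \<ge> 90\<close>.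
  For \<open>n \<ge> 5\<close> this suffices separately for the exponential and for the polynomial part of the
  numerator. At \<open>n = 4\<close> the exponential part alone just fails, so that value is computed.
\<close>
lemma trig_coeff_Suc_le:
  assumes n: "4 \<le> n"
  shows "4 * trig_coeff (Suc n) \<le> trig_coeff n"
proof (cases "n = 4")
  case True
  then show ?thesis by (simp add: trig_coeff_def fact_numeral)
next
  case False
  define r where "r = real n"
  define p :: real where "p = 9 ^ n"
  have r: "5 \<le> r" using n False by (simp add: r_def)
  have p: "0 \<le> p" by (simp add: p_def)
  let ?P = "p * (8 * r - 27) + (288 * r ^ 2 - 144 * r + 27)"
  let ?Q = "9 * p * (8 * r - 19) + (288 * r ^ 2 + 432 * r + 171)"
  have rr: "5 * r \<le> r ^ 2" using r by (simp add: power2_eq_square)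
  have "p * (36 * (8 * r - 19)) \<le> p * (90 * (8 * r - 27))"
    using r p by (intro mult_left_mono) auto
  moreover have "4 * (288 * q + 432 * r + 171) \<le> 90 * (288 * q - 144 * r + 27)"
    if "5 * r \<le> q" for q
    using r that by simp
  note this[OF rr]
  ultimately have "4 * ?Q \<le> 90 * ?P"
    by (simp add: algebra_simps)
  also have "\<dots> \<le> ((2 * r + 2) * (2 * r + 1)) * ?P"
  proof (rule mult_right_mono)
    have "10 * 9 \<le> (2 * r + 2) * (2 * r + 1)" using r by (intro mult_mono) auto
    then show "90 \<le> (2 * r + 2) * (2 * r + 1)" by simp
    show "0 \<le> ?P" using r p rr by (intro add_nonneg_nonneg mult_nonneg_nonneg) auto
  qed
  finally have *: "4 * ?Q \<le> ((2 * r + 2) * (2 * r + 1)) * ?P" .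
  have F: "fact (2 * Suc n) = ((2 * r + 2) * (2 * r + 1)) * (fact (2 * n) :: real)"
    by (simp add: r_def algebra_simps)
  have "trig_coeff (Suc n) = ?Q / (12 * (((2 * r + 2) * (2 * r + 1)) * fact (2 * n)))"
    unfolding trig_coeff_def F by (simp add: r_def p_def algebra_simps power2_eq_square)
  moreover have "trig_coeff n = ?P / (12 * fact (2 * n))"
    by (simp add: trig_coeff_def r_def p_def)
  moreover have "4 * (Q / (12 * (k * d))) \<le> P / (12 * d)"
    if "0 < k" "0 < d" "4 * Q \<le> k * P" for Q P k d :: real
    using that by (simp add: field_simps)
  note this[OF _ _ *, of "fact (2 * n)"]
  ultimately show ?thesis using r by simp
qed

text \<open>
  By \<open>cos (3 x) = 4 cos\<^sup>3 x - 3 cos x\<close>, the product \<open>9 sin\<^sup>2 x cos x\<close> is a linear combination of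
  \<open>cos x\<close> and \<open>cos (3 x)\<close>, so only the series of sine and cosine are needed, without any
  Cauchy product.
\<close>
lemma trig_expression_sums:
  fixes x :: real
  shows "(\<lambda>n. (-1) ^ n * (trig_coeff n * x ^ (2 * n))) sums
    (9 * (sin x)\<^sup>2 * cos x - x * sin (3 * x) - 6 * x\<^sup>2 * cos x)"
proof -
  have cos3: "9 * (sin x)\<^sup>2 * cos x = 9 / 4 * cos x - 9 / 4 * cos (3 * x)"
    unfolding cos_treble_cos sin_squared_eq
    by (simp add: algebra_simps power3_eq_cube power2_eq_square)
  have cos_s: "(\<lambda>n. (-1) ^ n / fact (2 * n) * y ^ (2 * n)) sums cos y" for y :: real
    using cos_paired[of y] by simp
  \<comment> \<open>The factors \<open>x\<close> and \<open>x\<^sup>2\<close> shift the index by one. With the factorials rewritten to \<open>(2 n)!\<close>,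
    the shifted terms carry a factor \<open>n\<close>, so the new term at \<open>0\<close> vanishes.\<close>
  define S where "S n = (-1) ^ n * 2 * real n / (3 * fact (2 * n)) * (3 * x) ^ (2 * n)" for n
  have S_Suc: "S (Suc n) = - x * ((-1) ^ n / fact (2 * n + 1) * (3 * x) ^ (2 * n + 1))" for n
  proof -
    have "fact (2 * Suc n) = (2 * real (Suc n)) * (fact (2 * n + 1) :: real)"
      by simp
    moreover have "(3 * x) ^ (2 * Suc n) = 3 * x * (3 * x) ^ (2 * n + 1)"
      by simp
    ultimately show ?thesis unfolding S_def
      by (simp only: power_Suc) (simp del: fact_Suc power_Suc power_Suc2 add: divide_simps)
  qed
  have S: "S sums (- (x * sin (3 * x)))"
  proof (rule sums_Suc_imp)
    show "(\<lambda>n. S (Suc n)) sums (- (x * sin (3 * x)))"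
      unfolding S_Suc using sums_mult[OF sin_paired[of "3 * x"], of "- x"] by simp
  qed (simp add: S_def)
  define C where "C n = (-1) ^ n * 12 * real n * (2 * real n - 1) / fact (2 * n) * x ^ (2 * n)" for n
  have C_Suc: "C (Suc n) = - 6 * x\<^sup>2 * ((-1) ^ n / fact (2 * n) * x ^ (2 * n))" for n
  proof -
    have "fact (2 * Suc n) = (2 * real (Suc n)) * (2 * real (Suc n) - 1) * (fact (2 * n) :: real)"
      by simp
    moreover have "e * 12 * m * (2 * m - 1) / (2 * m * (2 * m - 1) * d) * y = 6 * (e / d * y)"
      if "1 \<le> m" "0 < d" for e m d y :: real
    proof -
      have "e * 12 * m * (2 * m - 1) = (2 * m * (2 * m - 1)) * (6 * e)" by simp
      moreover have "2 * m * (2 * m - 1) \<noteq> 0" using that by simp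
      ultimately show ?thesis by (simp only: mult_divide_mult_cancel_left) simp
    qed
    note this[of "real (Suc n)" "fact (2 * n)" "(-1) ^ Suc n" "x ^ (2 * Suc n)"]
    ultimately show ?thesis
      by (simp add: C_def power2_eq_square del: fact_Suc of_nat_Suc)
  qed
  have C: "C sums (- (6 * x\<^sup>2 * cos x))"
  proof (rule sums_Suc_imp)
    show "(\<lambda>n. C (Suc n)) sums (- (6 * x\<^sup>2 * cos x))"
      unfolding C_Suc using sums_mult[OF cos_s[of x], of "- 6 * x\<^sup>2"] by simp
  qed (simp add: C_def)
  note A = sums_add[OF sums_add[OF sums_diff[OF sums_mult[OF cos_s[of x], of "9/4"]
    sums_mult[OF cos_s[of "3 * x"], of "9/4"]] S] C]
  have "(\<lambda>n. (-1) ^ n * (trig_coeff n * x ^ (2 * n))) =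
    (\<lambda>n. 9 / 4 * ((-1) ^ n / fact (2 * n) * x ^ (2 * n)) -
      9 / 4 * ((-1) ^ n / fact (2 * n) * (3 * x) ^ (2 * n)) +
      S n + C n)"
    (is "?l = ?r")
  proof
    fix n
    have "(3 * x) ^ (2 * n) = 9 ^ n * x ^ (2 * n)" by (simp add: power_mult_distrib power_mult)
    then show "?l n = ?r n"
      unfolding trig_coeff_def S_def C_def
      by (simp only:) (simp add: field_simps power2_eq_square)
  qed
  then show ?thesis using A unfolding cos3 by simp
qed

lemma trig_expression_pos:
  fixes x :: real
  assumes "0 < x" "x < pi / 2"
  shows "0 < 9 * (sin x)\<^sup>2 * cos x - x * sin (3 * x) - 6 * x\<^sup>2 * cos x" (is "0 < ?E")
proof -
  have "x < 2" using assms pi_half_less_two by linarith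
  then have "x * x < 2 * 2" using assms by (intro mult_strict_mono) auto
  then have x2: "x\<^sup>2 < 4" by (simp add: power2_eq_square)
  define a where "a n = trig_coeff (n + 4) * x ^ (2 * (n + 4))" for n
  have a_pos: "0 < a n" for n
    using trig_coeff_pos[of "n + 4"] assms by (simp add: a_def)
  have a_dec: "a (Suc n) < a n" for n
  proof -
    have "a (Suc n) = (trig_coeff (Suc (n + 4)) * x\<^sup>2) * x ^ (2 * (n + 4))"
      by (simp add: a_def power2_eq_square mult_ac flip: power_Suc)
    also have "\<dots> < (trig_coeff (Suc (n + 4)) * 4) * x ^ (2 * (n + 4))"
      using x2 assms trig_coeff_pos[of "Suc (n + 4)"]
      by (intro mult_strict_right_mono mult_strict_left_mono) auto
    also have "\<dots> \<le> a n" unfolding a_def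
      using trig_coeff_Suc_le[of "n + 4"] assms by (intro mult_right_mono) auto
    finally show ?thesis .
  qed
  have "(\<lambda>n. (-1) ^ (n + 4) * (trig_coeff (n + 4) * x ^ (2 * (n + 4)))) sums
      (?E - (\<Sum>n<4. (-1) ^ n * (trig_coeff n * x ^ (2 * n))))"
    using sums_split_initial_segment[OF trig_expression_sums[of x], of 4] by simp
  moreover have "(\<Sum>n<4. (-1) ^ n * (trig_coeff n * x ^ (2 * n))) = 0"
    by (simp add: trig_coeff_eq_0)
  ultimately have sums: "(\<lambda>n. (-1) ^ n * a n) sums ?E"
    by (simp add: a_def power_add)
  then have "(\<lambda>n. (-1) ^ n * a n) \<longlonglongrightarrow> 0"
    by (intro summable_LIMSEQ_zero sums_summable)
  then have "(\<lambda>n. norm ((-1) ^ n * a n)) \<longlonglongrightarrow> 0" by (rule tendsto_norm_zero)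
  then have "a \<longlonglongrightarrow> 0" using a_pos by (simp add: abs_mult less_imp_le)
  \<comment> \<open>The alternating sum is at least its partial sum of two terms.\<close>
  from summable_Leibniz'(2)[OF this, of 1]
  have "a 0 - a 1 \<le> ?E"
    using a_pos a_dec sums_unique[OF sums] by (simp add: less_imp_le numeral_2_eq_2)
  then show ?thesis using a_dec[of 0] by simp
qed

section \<open>The upper bound\<close>

text \<open>
  The expression is the derivative of \<open>9/5 ln x + 6/5 ln (tan x) - ln (3 (tan x - x))\<close>. Over the
  positive common denominator \<open>5 x t (t - x)\<close>, where \<open>t = tan x\<close>, its numerator times \<open>cos\<^sup>3 x\<close> is the
  trigonometric expression shown positive above, since \<open>sin (3 x) = sin x (3 - 4 sin\<^sup>2 x)\<close>.
\<close>
lemma log_ratio_derivative_pos: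
  fixes x :: real
  assumes "0 < x" "x < pi / 2"
  shows "0 < 9 / (5 * x) + 6 * (1 + (tan x)\<^sup>2) / (5 * tan x) - (tan x)\<^sup>2 / (tan x - x)"
proof -
  define c where "c = cos x"
  define s where "s = sin x"
  define t where "t = tan x"
  have c: "0 < c" unfolding c_def using assms by (intro cos_gt_zero_pi) auto
  have t: "0 < t" "x < t" using x_less_tan[OF assms] assms by (auto simp: t_def)
  have s: "s = t * c" using c by (simp add: s_def t_def c_def tan_def)
  have sc: "c\<^sup>2 * (1 + t\<^sup>2) = 1"
    using sin_cos_squared_add[of x] unfolding s_def[symmetric] c_def[symmetric] s
    by (simp add: power2_eq_square algebra_simps)
  have "sin (3 * x) = s * (3 - 4 * s\<^sup>2)"
    using sin_add[of "2 * x" x] sin_cos_squared_add[of x]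
    by (simp add: sin_double cos_double s_def power2_eq_square) algebra
  then have E: "0 < 9 * s\<^sup>2 * c - x * (s * (3 - 4 * s\<^sup>2)) - 6 * x\<^sup>2 * c"
    using trig_expression_pos[OF assms] by (simp add: s_def c_def)
  let ?N = "9 * t * (t - x) + 6 * x * (1 + t\<^sup>2) * (t - x) - 5 * x * t ^ 3"
  have "c ^ 3 * ?N = 9 * s\<^sup>2 * c - x * (s * (3 - 4 * s\<^sup>2)) - 6 * x\<^sup>2 * c"
    unfolding s using sc by algebra
  with E c have "0 < ?N" by (metis zero_less_mult_pos zero_less_power)
  moreover have "9 / (5 * x) + 6 * (1 + t\<^sup>2) / (5 * t) - t\<^sup>2 / (t - x)
      = ?N / (5 * x * t * (t - x))"
    using t assms by (simp add: field_simps power2_eq_square power3_eq_cube)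
  ultimately show ?thesis using t assms unfolding t_def[symmetric]
    by (simp add: zero_less_divide_iff)
qed

lemma upper_bound:
  fixes x :: real
  assumes "0 < x" "x < pi / 2"
  shows "3 * (tan x - x) < x powr (9 / 5) * tan x powr (6 / 5)"
proof -
  define h where "h y = 9 / 5 * ln y + 6 / 5 * ln (tan y) - ln (3 * (tan y - y))" for y :: real
  have mono: "h y < h z" if "0 < y" "y < z" "z < pi / 2" for y z
  proof (rule DERIV_pos_imp_increasing[OF \<open>y < z\<close>])
    fix u assume u: "y \<le> u" "u \<le> z"
    then have u': "0 < u" "u < pi / 2" using that by auto
    then have c: "cos u \<noteq> 0" using cos_gt_zero_pi[of u] by auto
    have t: "0 < tan u" "u < tan u" using x_less_tan[OF u'] u' by auto
    have sec: "inverse ((cos u)\<^sup>2) = 1 + (tan u)\<^sup>2"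
      using tan_sec[OF c] by (simp add: power_inverse)
    have d3: "((\<lambda>y. 3 * (tan y - y)) has_real_derivative 3 * (tan u)\<^sup>2) (at u)"
      using c by (auto intro!: derivative_eq_intros simp: sec)
    have "(h has_real_derivative
        9 / (5 * u) + 6 * (1 + (tan u)\<^sup>2) / (5 * tan u) - (tan u)\<^sup>2 / (tan u - u)) (at u)"
      unfolding h_def using u' t c
      by (auto intro!: derivative_eq_intros d3 simp: sec; simp add: field_simps)
    with log_ratio_derivative_pos[OF u']
    show "\<exists>d. (h has_real_derivative d) (at u) \<and> 0 < d" by blast
  qed
  have lim: "(h \<longlongrightarrow> 0) (at_right 0)"
    unfolding h_def by real_asymp
  \<comment> \<open>The limit only gives a weak inequality; passing from \<open>x / 2\<close> to \<open>x\<close> makes it strict.\<close>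
  have half: "0 \<le> h (x / 2)"
  proof (rule tendsto_upperbound[OF lim])
    show "\<forall>\<^sub>F y in at_right 0. h y \<le> h (x / 2)"
      unfolding eventually_at_right_field
      using assms by (intro exI[of _ "x / 2"]) (auto intro!: less_imp_le[OF mono])
  qed simp
  also have "\<dots> < h x" using assms by (intro mono) auto
  finally have "ln (3 * (tan x - x)) < 9 / 5 * ln x + 6 / 5 * ln (tan x)"
    by (simp add: h_def)
  moreover have t: "0 < tan x" "x < tan x" using x_less_tan[OF assms] assms by auto
  ultimately show ?thesis using assms
    by (subst ln_less_cancel_iff[symmetric]) (auto simp: ln_mult ln_powr)
qed

theorem mainTheorem1:
  shows "(\<forall>x::real. 0 < x \<and> x < pi / 2 \<longrightarrow> f 1 x < 3 * (tan x - x))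
    \<and> (\<forall>x::real. 0 < x \<and> x < pi / 2 \<longrightarrow> 3 * (tan x - x) < f (6 / 5) x)
    \<and> (\<forall>x::real. 0 < x \<and> x < pi / 2 \<longrightarrow>
          x + 1 / 3 * x ^ 2 * tan x < tan x
          \<and> tan x < x + 1 / 3 * x powr (9 / 5) * tan x powr (6 / 5))"
proof (intro conjI allI impI; elim conjE)
  fix x :: real
  assume x: "0 < x" "x < pi / 2"
  have t: "0 < tan x" using x_less_tan[OF x] x by simp
  note lo = lower_bound[OF x] and up = upper_bound[OF x]
  show "f 1 x < 3 * (tan x - x)" using lo x t by (simp add: f_def)
  show "3 * (tan x - x) < f (6 / 5) x" using up by (simp add: f_def)
  show "x + 1 / 3 * x ^ 2 * tan x < tan x" using lo by simp
  show "tan x < x + 1 / 3 * x powr (9 / 5) * tan x powr (6 / 5)" using up by simp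
qed

end
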